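(* Let $\epsilon\in(0,1)$ and let $\pi$ be any schedule of $n$ jobs with $\mathrm{Cost}(\pi)>(1+\epsilon)\,\mathrm{OPT}$. Then there exists a schedule $\pi'$ obtainable from $\pi$ by swapping (the positions of) a single pair of jobs such that $$\mathrm{Cost}(\pi')\le\left(1-\frac{\epsilon}{n^2}\right)\mathrm{Cost}(\pi).$$
   Context: There are $n$ jobs with random sizes $P=(P_1,\dots,P_n)\sim\mathcal{D}$ taking values in $[0,1]^n$ (possibly correlated across jobs). A schedule is a permutation $\pi$ of $[n]$, with job $j$ in position $\pi(j)$. The total completion time is $\mathrm{Cost}(\pi,P)=\sum_{j=1}^n(n-\pi(j)+1)P_j$. Write $\mathrm{Cost}(\pi)=\mathbb{E}_{P\sim\mathcal{D}}[\mathrm{Cost}(\pi,P)]$ and $\mathrm{OPT}=\min_\pi\mathrm{Cost}(\pi)$ over all permutations of $[n]$. *)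

theory Defs
  imports "HOL-Probability.Probability" "HOL-Combinatorics.Permutations"
begin

text \<open>
  Jobs are the elements of \<^term>\<open>{1..n}\<close>. A schedule is a permutation \<open>\<pi>\<close> of
  \<^term>\<open>{1..n}\<close>, where \<open>\<pi> j\<close> is the position (not the other way round) of job \<open>j\<close>.
\<close>

definition schedule :: "nat \<Rightarrow> (nat \<Rightarrow> nat) \<Rightarrow> bool" where
  "schedule n \<pi> \<longleftrightarrow> \<pi> permutes {1..n}"

text \<open>
  The cube \<open>[0,1]\<^sup>n\<close> as a measurable space with its (product) Borel sigma-algebra. The
  measure component of this product is never used: a size distribution is an arbitrary,
  not necessarily product, probability measure on these measurable sets.
\<close>

definition size_space :: "nat \<Rightarrow> (nat \<Rightarrow> real) measure" where
  "size_space n = (\<Pi>\<^sub>M j\<in>{1..n}. restrict_space borel {0..1})"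

definition size_distribution :: "nat \<Rightarrow> (nat \<Rightarrow> real) measure \<Rightarrow> bool" where
  "size_distribution n D \<longleftrightarrow> prob_space D \<and> sets D = sets (size_space n)"

definition realized_cost :: "nat \<Rightarrow> (nat \<Rightarrow> nat) \<Rightarrow> (nat \<Rightarrow> real) \<Rightarrow> real" where
  "realized_cost n \<pi> P = (\<Sum>j=1..n. (real n - real (\<pi> j) + 1) * P j)"

definition Cost :: "nat \<Rightarrow> (nat \<Rightarrow> real) measure \<Rightarrow> (nat \<Rightarrow> nat) \<Rightarrow> real" where
  "Cost n D \<pi> = (\<integral>P. realized_cost n \<pi> P \<partial>D)"

definition OPT :: "nat \<Rightarrow> (nat \<Rightarrow> real) measure \<Rightarrow> real" where
  "OPT n D = Min (Cost n D ` {\<pi>. schedule n \<pi>})"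

definition swap_jobs :: "nat \<Rightarrow> nat \<Rightarrow> (nat \<Rightarrow> nat) \<Rightarrow> (nat \<Rightarrow> nat)" where
  "swap_jobs i j \<pi> = \<pi>(i := \<pi> j, j := \<pi> i)"

end

theory Submission
  imports Defs
begin

text \<open>
  With \<open>p j\<close> the expected size of job \<open>j\<close>, the cost of a schedule is the sum of \<open>p j\<close> over all
  ordered pairs \<open>(j, k)\<close> such that \<open>j\<close> does not come after \<open>k\<close>. Symmetrizing, the difference of
  the costs of two schedules splits over unordered pairs, and if every pair placed in the order
  \<open>i, j\<close> by \<open>\<pi>\<close> satisfies \<open>p i - p j \<le> d\<close>, then \<open>\<pi>\<close> exceeds any other schedule by at most
  \<open>d n\<^sup>2 / 2\<close>. With \<open>d = \<epsilon> Cost(\<pi>) / n\<^sup>2\<close> this would contradict \<open>Cost(\<pi>) > (1 + \<epsilon>) OPT\<close>, since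
  \<open>(1 + \<epsilon>) (1 - \<epsilon> / 2) > 1\<close>. So some pair has \<open>p i - p j > d\<close>, and swapping it gains at least
  \<open>p i - p j\<close>.
\<close>

lemma size_distribution_component:
  assumes "size_distribution n D" and "j \<in> {1..n}"
  shows "integrable D (\<lambda>P. P j)" and "0 \<le> (\<integral>P. P j \<partial>D)"
proof -
  interpret prob_space D
    using assms by (simp add: size_distribution_def)
  have sets: "sets D = sets (size_space n)"
    using assms by (simp add: size_distribution_def)
  have "(\<lambda>P. P j) \<in> size_space n \<rightarrow>\<^sub>M restrict_space borel {0..1::real}"
    unfolding size_space_def using assms(2) by (rule measurable_component_singleton)
  then have *: "(\<lambda>P. P j) \<in> borel_measurable D"
    by (simp add: measurable_restrict_space2_iff measurable_cong_sets[OF sets refl])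
  have bound: "P j \<in> {0..1}" if "P \<in> space D" for P
    using that assms(2)
    by (auto simp: sets_eq_imp_space_eq[OF sets] size_space_def space_PiM space_restrict_space
        PiE_iff)
  show "integrable D (\<lambda>P. P j)"
    using * bound by (intro integrable_const_bound[where B = 1]) auto
  show "0 \<le> (\<integral>P. P j \<partial>D)"
    using bound by (intro integral_nonneg_AE) auto
qed

text \<open>Linearity of expectation holds under any correlation between the sizes. The cost
  therefore depends on \<open>D\<close> only through the mean sizes, and the remaining argument is
  deterministic.\<close>

lemma Cost_eq_realized_cost_mean:
  assumes "size_distribution n D"
  shows "Cost n D \<pi> = realized_cost n \<pi> (\<lambda>j. \<integral>P. P j \<partial>D)"
  unfolding Cost_def realized_cost_def
  using size_distribution_component(1)[OF assms]
  by (subst Bochner_Integration.integral_sum) auto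

lemma realized_cost_nonneg:
  assumes "schedule n \<pi>" and "\<And>j. j \<in> {1..n} \<Longrightarrow> 0 \<le> p j"
  shows "0 \<le> realized_cost n \<pi> p"
  unfolding realized_cost_def
proof (intro sum_nonneg mult_nonneg_nonneg)
  fix j assume j: "j \<in> {1..n}"
  then have "\<pi> j \<in> {1..n}"
    using assms(1) permutes_in_image unfolding schedule_def by metis
  then show "0 \<le> real n - real (\<pi> j) + 1"
    by simp
qed (use assms in auto)

lemma swap_jobs_eq_comp_transpose: "swap_jobs i j \<pi> = \<pi> \<circ> Transposition.transpose i j"
  by (auto simp: swap_jobs_def Transposition.transpose_def fun_eq_iff)

lemma schedule_swap_jobs:
  assumes "schedule n \<pi>" and "i \<in> {1..n}" and "j \<in> {1..n}"
  shows "schedule n (swap_jobs i j \<pi>)"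
  using assms unfolding schedule_def swap_jobs_eq_comp_transpose
  by (intro permutes_compose permutes_swap_id)

text \<open>Only the terms of \<open>i\<close> and \<open>j\<close> change. The subtracted product
  is a gain when the job with the larger \<open>p\<close> stands first.\<close>

lemma realized_cost_swap_jobs:
  assumes "i \<in> {1..n}" and "j \<in> {1..n}" and "i \<noteq> j"
  shows "realized_cost n (swap_jobs i j \<pi>) p
    = realized_cost n \<pi> p - (real (\<pi> j) - real (\<pi> i)) * (p i - p j)"
proof -
  have split: "sum f {1..n} = f i + (f j + sum f ({1..n} - {i} - {j}))" for f :: "nat \<Rightarrow> real"
    using assms by (simp add: sum.remove)
  show ?thesis
    unfolding realized_cost_def split using assms(3)
    by (simp add: swap_jobs_def algebra_simps)
qed

text \<open>The weight of job \<open>j\<close> counts the positions from \<open>\<pi> j\<close> to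
  \<open>n\<close>, hence the jobs \<open>k\<close> not placed before \<open>j\<close>. The
  \<open>+ 1\<close> accounts for \<open>k = j\<close>.\<close>

lemma realized_cost_eq_sum_pairs:
  assumes "schedule n \<pi>"
  shows "realized_cost n \<pi> p = (\<Sum>j=1..n. \<Sum>k=1..n. of_bool (\<pi> j \<le> \<pi> k) * p j)"
  unfolding realized_cost_def
proof (rule sum.cong)
  fix j assume j: "j \<in> {1..n}"
  have perm: "\<pi> permutes {1..n}"
    using assms by (simp add: schedule_def)
  have "\<pi> j \<in> {1..n}"
    using perm j permutes_in_image by metis
  \<comment> \<open>Reindexing along \<open>\<pi>\<close> turns the sum over jobs into a sum over
    positions.\<close>
  have "(\<Sum>k=1..n. of_bool (\<pi> j \<le> \<pi> k) * p j) = (\<Sum>k=1..n. of_bool (\<pi> j \<le> k) * p j)"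
    using sum.permute[OF perm, of "\<lambda>k. of_bool (\<pi> j \<le> k) * p j"] unfolding o_def by (rule sym)
  also have "\<dots> = real (card {k \<in> {1..n}. \<pi> j \<le> k}) * p j"
    by (simp flip: sum_distrib_right sum.inter_filter add: of_bool_def Int_def)
  also have "{k \<in> {1..n}. \<pi> j \<le> k} = {\<pi> j..n}"
    using \<open>\<pi> j \<in> {1..n}\<close> by auto
  also have "real (card {\<pi> j..n}) = real n - real (\<pi> j) + 1"
    using \<open>\<pi> j \<in> {1..n}\<close> by (simp add: of_nat_diff)
  finally show "(real n - real (\<pi> j) + 1) * p j = (\<Sum>k=1..n. of_bool (\<pi> j \<le> \<pi> k) * p j)"
    by (rule sym)
qed simp

lemma realized_cost_diff_le:
  assumes \<pi>: "schedule n \<pi>" and \<sigma>: "schedule n \<sigma>" and "0 \<le> d"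
    and d: "\<And>i j. i \<in> {1..n} \<Longrightarrow> j \<in> {1..n} \<Longrightarrow> \<pi> i < \<pi> j \<Longrightarrow> p i - p j \<le> d"
  shows "2 * (realized_cost n \<pi> p - realized_cost n \<sigma> p) \<le> (real n)\<^sup>2 * d"
proof -
  \<comment> \<open>For distinct jobs, \<open>t \<tau> j k\<close> is the size of whichever job
    \<open>\<tau>\<close> places first. On the diagonal it is \<open>2 * p j\<close> for every
    schedule, so it cancels in differences.\<close>
  define t where
    "t \<tau> j k = of_bool (\<tau> j \<le> \<tau> k) * p j + of_bool (\<tau> k \<le> \<tau> j) * p k"
    for \<tau> :: "nat \<Rightarrow> nat" and j k :: nat
  have twice: "2 * realized_cost n \<tau> p = (\<Sum>j=1..n. \<Sum>k=1..n. t \<tau> j k)" if "schedule n \<tau>" for \<tau>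
    unfolding t_def sum.distrib
    using sum.swap[of "\<lambda>j k. of_bool (\<tau> k \<le> \<tau> j) * p k" "{1..n}" "{1..n}"]
    by (simp add: realized_cost_eq_sum_pairs[OF that])
  \<comment> \<open>If both schedules order the pair alike, the difference is 0. Otherwise it is the
    size of the job first in \<open>\<pi>\<close> minus that of the other, which \<open>d\<close>
    bounds.\<close>
  have le: "t \<pi> j k - t \<sigma> j k \<le> d" if "j \<in> {1..n}" "k \<in> {1..n}" for j k
  proof (cases "j = k")
    case False
    then have "\<pi> j \<noteq> \<pi> k" "\<sigma> j \<noteq> \<sigma> k"
      using \<pi> \<sigma> by (auto simp: schedule_def dest: permutes_inj injD)
    then show ?thesis
      using d[OF that] d[OF that(2,1)] \<open>0 \<le> d\<close>
      by (cases "\<pi> j < \<pi> k"; cases "\<sigma> j < \<sigma> k") (auto simp: t_def)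
  qed (use \<open>0 \<le> d\<close> in \<open>simp add: t_def\<close>)
  have "2 * (realized_cost n \<pi> p - realized_cost n \<sigma> p)
      = (\<Sum>j=1..n. \<Sum>k=1..n. t \<pi> j k - t \<sigma> j k)"
    by (simp add: right_diff_distrib twice \<pi> \<sigma> sum_subtractf)
  also have "\<dots> \<le> (\<Sum>j=1..n. \<Sum>k=1..n. d)"
    by (intro sum_mono le)
  also have "\<dots> = (real n)\<^sup>2 * d"
    by (simp add: power2_eq_square)
  finally show ?thesis .
qed

lemma OPT_attained:
  obtains \<sigma> where "schedule n \<sigma>" and "OPT n D = Cost n D \<sigma>"
proof -
  have "finite {\<sigma>. schedule n \<sigma>}" "id \<in> {\<sigma>. schedule n \<sigma>}"
    by (auto simp: schedule_def finite_permutations permutes_id)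
  then have "OPT n D \<in> Cost n D ` {\<sigma>. schedule n \<sigma>}"
    unfolding OPT_def by (intro Min_in) auto
  then show ?thesis
    using that by auto
qed

theorem lemma4p2:
  fixes n :: nat and D :: "(nat \<Rightarrow> real) measure" and \<epsilon> :: real and \<pi> :: "nat \<Rightarrow> nat"
  assumes "size_distribution n D"
    and "0 < \<epsilon>" and "\<epsilon> < 1"
    and "schedule n \<pi>"
    and "Cost n D \<pi> > (1 + \<epsilon>) * OPT n D"
  shows "\<exists>\<pi>'. schedule n \<pi>' \<and>
           (\<exists>i\<in>{1..n}. \<exists>j\<in>{1..n}. i \<noteq> j \<and> \<pi>' = swap_jobs i j \<pi>) \<and>
           Cost n D \<pi>' \<le> (1 - \<epsilon> / (real n)^2) * Cost n D \<pi>"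
proof -
  define p where "p j = (\<integral>P. P j \<partial>D)" for j
  define d where "d = \<epsilon> * Cost n D \<pi> / (real n)\<^sup>2"
  have cost: "Cost n D \<tau> = realized_cost n \<tau> p" for \<tau>
    unfolding p_def by (rule Cost_eq_realized_cost_mean[OF assms(1)])
  obtain \<sigma> where \<sigma>: "schedule n \<sigma>" "OPT n D = Cost n D \<sigma>"
    by (rule OPT_attained)
  have "0 \<le> Cost n D \<sigma>"
    unfolding cost p_def using \<sigma>(1) size_distribution_component(2)[OF assms(1)]
    by (rule realized_cost_nonneg)
  then have "0 \<le> (1 + \<epsilon>) * Cost n D \<sigma>"
    using assms(2) by simp
  then have pos: "0 < Cost n D \<pi>"
    using assms(5) unfolding \<sigma>(2) by (rule le_less_trans)
  \<comment> \<open>For \<open>n = 0\<close> the cost is an empty sum, hence not positive.\<close>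
  then have "n \<noteq> 0"
    unfolding cost by (intro notI) (simp add: realized_cost_def)
  have "0 < d"
    using pos \<open>n \<noteq> 0\<close> assms(2) by (simp add: d_def)
  have "\<exists>i\<in>{1..n}. \<exists>j\<in>{1..n}. \<pi> i < \<pi> j \<and> d < p i - p j"
  proof (rule ccontr)
    assume "\<not> ?thesis"
    then have "p i - p j \<le> d" if "i \<in> {1..n}" "j \<in> {1..n}" "\<pi> i < \<pi> j" for i j
      using that not_less by blast
    then have "2 * (Cost n D \<pi> - Cost n D \<sigma>) \<le> (real n)\<^sup>2 * d"
      unfolding cost using assms(4) \<sigma>(1) \<open>0 < d\<close>
      by (intro realized_cost_diff_le) auto
    also have "\<dots> = \<epsilon> * Cost n D \<pi>"
      using \<open>n \<noteq> 0\<close> by (simp add: d_def)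
    \<comment> \<open>The factor \<open>1 + \<epsilon>\<close> makes the assumed gap to
      \<open>OPT\<close> applicable. The contradiction comes from \<open>(1 + \<epsilon>) * (2 -
      \<epsilon>) - 2 = \<epsilon> * (1 - \<epsilon>)\<close>, which is positive.\<close>
    finally have "(1 + \<epsilon>) * ((2 - \<epsilon>) * Cost n D \<pi>) \<le> (1 + \<epsilon>) * (2 * Cost n D \<sigma>)"
      using assms(2) by (intro mult_left_mono) (auto simp: algebra_simps)
    also have "\<dots> < 2 * Cost n D \<pi>"
      using assms(5) \<sigma>(2) by simp
    finally have "\<epsilon> * (1 - \<epsilon>) * Cost n D \<pi> < 0"
      by (simp add: algebra_simps)
    then show False
      using assms(2,3) pos by (simp add: mult_less_0_iff)
  qed
  then obtain i j where ij: "i \<in> {1..n}" "j \<in> {1..n}" "\<pi> i < \<pi> j" "d < p i - p j"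
    by blast
  then have "i \<noteq> j"
    by auto
  \<comment> \<open>Positions are integers, so \<open>\<pi> i < \<pi> j\<close> makes the first
    factor at least 1.\<close>
  have "1 * d \<le> (real (\<pi> j) - real (\<pi> i)) * (p i - p j)"
    using ij \<open>0 < d\<close> by (intro mult_mono) auto
  then have "Cost n D (swap_jobs i j \<pi>) \<le> Cost n D \<pi> - d"
    unfolding cost realized_cost_swap_jobs[OF ij(1,2) \<open>i \<noteq> j\<close>] by simp
  also have "\<dots> = (1 - \<epsilon> / (real n)^2) * Cost n D \<pi>"
    by (simp add: d_def algebra_simps)
  finally show ?thesis
    using ij \<open>i \<noteq> j\<close> schedule_swap_jobs[OF assms(4) ij(1,2)] by blast
qed

end
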